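(* For a connected graph $G$ of order at least two, $\mathrm{cdim}(G) \leq 2$ if and only if $G \in \mathcal{F}_r$ for some nonnegative integer $r$.
   Context: All graphs are finite, simple, undirected; membership in $\mathcal{F}_r$ is up to isomorphism. A set $S\subseteq V(G)$ is a resolving set of $G$ if for every pair of distinct vertices $x,y$ of $G$ there is $z\in S$ with $d(x,z)\ne d(y,z)$ ($d$ is the shortest-path distance); it is a connected resolving set if moreover the induced subgraph $G[S]$ is connected. $\mathrm{cdim}(G)$ is the minimum cardinality of a connected resolving set of $G$. The family $\mathcal{F}_r$: $\mathcal{F}_0=\{P_2\}$ with $V(P_2)=\{u,w\}$. For $r\ge 1$, $\mathcal{F}_r$ consists of all graphs $G$ with $uw\in E(G)$ satisfying: (R1) $\{u,w\}\subseteq V(G)\subseteq \{u,w\}\cup\{x_a,y_a,z_a:1\leq a\leq r\}$ (all these symbols denoting distinct vertices); (R2) if $x_1 \in V(G)$, then $x_1u \in E(G)$; (R3) if $z_1 \in V(G)$, then $z_1w \in E(G)$; (R4) if $y_1 \in V(G)$, then $y_1u, y_1w \in E(G)$; (R5) if $x_a \in V(G)$ with $2 \leq a \leq r$, then $x_{a-1} \in V(G)$ and $x_ax_{a-1} \in E(G)$; (R6) if $z_a \in V(G)$ with $2 \leq a \leq r$, then $z_{a-1} \in V(G)$ and $z_az_{a-1} \in E(G)$; (R7) if $y_a \in V(G)$ with $2 \leq a \leq r$, then at least one of the following is true: (i) $x_{a-1}, z_{a-1} \in V(G)$ and $x_{a-1}y_a, z_{a-1}y_a \in E(G)$; (ii)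 $y_{a-1} \in V(G)$ and $y_{a-1}y_a \in E(G)$; (R8) any of the edges $x_ay_a$, $x_az_a$, $y_az_a$ (between vertices present in $G$) may or may not be in $E(G)$, for each $1 \leq a \leq r$; (R9) there are no other edges in $G$, i.e. every edge of $G$ is $uw$ or of one of the types mentioned in (R2)–(R8): $x_1u$, $z_1w$, $y_1u$, $y_1w$, $x_ax_{a-1}$, $z_az_{a-1}$, $x_{a-1}y_a$, $z_{a-1}y_a$, $y_{a-1}y_a$ ($2\le a\le r$), $x_ay_a$, $x_az_a$, $y_az_a$ ($1\le a\le r$). In particular, provided (R7) holds, each individual edge $x_{a-1}y_a$, $z_{a-1}y_a$, $y_{a-1}y_a$ may be present or absent. *)

theory Defs
  imports "Graph_Theory.Graph_Theory"
begin

text \<open>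
  A finite simple undirected graph is a \<^locale>\<open>pair_graph\<close>: a finite, loop-free, symmetric set of
  arcs, each edge being represented by its two orientations.
\<close>

text \<open>Shortest-path distance: \<open>\<mu>\<close> is the least cost of a walk, here with unit weights.\<close>

definition gdist :: "'a pair_pre_digraph \<Rightarrow> 'a \<Rightarrow> 'a \<Rightarrow> ereal" where
  "gdist G x y = wf_digraph.\<mu> (with_proj G) (\<lambda>_. 1) x y"

definition resolving_set :: "'a pair_pre_digraph \<Rightarrow> 'a set \<Rightarrow> bool" where
  "resolving_set G S \<longleftrightarrow> S \<subseteq> pverts G \<and>
     (\<forall>x \<in> pverts G. \<forall>y \<in> pverts G. x \<noteq> y \<longrightarrow> (\<exists>z \<in> S. gdist G x z \<noteq> gdist G y z))"

definition connected_resolving_set :: "'a pair_pre_digraph \<Rightarrow> 'a set \<Rightarrow> bool" where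
  "connected_resolving_set G S \<longleftrightarrow>
     resolving_set G S \<and> Digraph_Component.connected (with_proj G \<restriction> S)"

text \<open>
  If \<open>G\<close> is finite and connected, \<^term>\<open>pverts G\<close> itself is a connected resolving set,
  so the minimum is attained.
\<close>

definition cdim :: "'a pair_pre_digraph \<Rightarrow> nat" where
  "cdim G = (LEAST k. \<exists>S. connected_resolving_set G S \<and> card S = k)"

text \<open>
  The symbols \<open>u, w, x\<^sub>a, y\<^sub>a, z\<^sub>a\<close>; being constructor terms they are pairwise distinct.
\<close>

datatype fvert = vu | vw | vx nat | vy nat | vz nat

text \<open>
  All edges that a member of the family may have, each listed in one orientation only.
\<close>

definition permitted_edges :: "nat \<Rightarrow> fvert rel" where
  "permitted_edges r =
     {(vu, vw), (vx 1, vu), (vz 1, vw), (vy 1, vu), (vy 1, vw)}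
     \<union> (\<Union>a\<in>{2..r}. {(vx a, vx (a - 1)), (vz a, vz (a - 1)),
                      (vx (a - 1), vy a), (vz (a - 1), vy a), (vy (a - 1), vy a)})
     \<union> (\<Union>a\<in>{1..r}. {(vx a, vy a), (vx a, vz a), (vy a, vz a)})"

text \<open>
  The edges \<open>x\<^sub>ay\<^sub>a\<close>, \<open>x\<^sub>az\<^sub>a\<close>, \<open>y\<^sub>az\<^sub>a\<close> are free, so they occur only in \<^const>\<open>permitted_edges\<close>.
  Adjacency is written in one orientation; symmetry comes from \<^locale>\<open>pair_graph\<close>
  in \<open>F_family\<close> below.
\<close>

definition F_rules :: "nat \<Rightarrow> fvert pair_pre_digraph \<Rightarrow> bool" where
  "F_rules r H \<longleftrightarrow>
     (let V = pverts H; E = parcs H in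
      (vu, vw) \<in> E \<and>
      {vu, vw} \<subseteq> V \<and> V \<subseteq> {vu, vw} \<union> (\<Union>a\<in>{1..r}. {vx a, vy a, vz a}) \<and>
      (vx 1 \<in> V \<longrightarrow> (vx 1, vu) \<in> E) \<and>
      (vz 1 \<in> V \<longrightarrow> (vz 1, vw) \<in> E) \<and>
      (vy 1 \<in> V \<longrightarrow> (vy 1, vu) \<in> E \<and> (vy 1, vw) \<in> E) \<and>
      (\<forall>a\<in>{2..r}. vx a \<in> V \<longrightarrow> vx (a - 1) \<in> V \<and> (vx a, vx (a - 1)) \<in> E) \<and>
      (\<forall>a\<in>{2..r}. vz a \<in> V \<longrightarrow> vz (a - 1) \<in> V \<and> (vz a, vz (a - 1)) \<in> E) \<and>
      (\<forall>a\<in>{2..r}. vy a \<in> V \<longrightarrow>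
         (vx (a - 1) \<in> V \<and> vz (a - 1) \<in> V \<and> (vx (a - 1), vy a) \<in> E \<and> (vz (a - 1), vy a) \<in> E)
         \<or> (vy (a - 1) \<in> V \<and> (vy (a - 1), vy a) \<in> E)) \<and>
      E \<subseteq> permitted_edges r \<union> (permitted_edges r)\<inverse>)"

definition F_family :: "nat \<Rightarrow> fvert pair_pre_digraph set" where
  "F_family r =
     (if r = 0 then {\<lparr> pverts = {vu, vw}, parcs = {(vu, vw), (vw, vu)} \<rparr>}
      else {H. pair_graph H \<and> F_rules r H})"

definition in_F :: "'a pair_pre_digraph \<Rightarrow> nat \<Rightarrow> bool" where
  "in_F G r \<longleftrightarrow> (\<exists>H \<in> F_family r. digraph_iso (with_proj G) (with_proj H))"

end

theory Submission
  imports Defs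
begin

text \<open>
  Why the theorem is true: two vertices \<open>u, w\<close> form a connected resolving set exactly when they are
  adjacent and every vertex \<open>v\<close> is determined by its coordinates \<open>(d(v, u), d(v, w))\<close>. As \<open>u\<close> and
  \<open>w\<close> are adjacent, these coordinates differ by at most one, so the possible positions are those of
  \<open>u, w\<close> and, for each \<open>a \<ge> 1\<close>, the points \<open>(a, a + 1)\<close>, \<open>(a, a)\<close>, \<open>(a + 1, a)\<close>, which are called
  \<open>x\<^sub>a, y\<^sub>a, z\<^sub>a\<close>. The rules of the family say nothing more than that the coordinates suggested by the
  names are the true distances to \<open>u\<close> and \<open>w\<close>: the edges that are permitted are those along which
  each coordinate changes by at most one, and the edges that are required are those that give each
  vertex a neighbour one step closer to \<open>u\<close>, and one step closer to \<open>w\<close>.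

  The argument rests on a local description of the distance to a vertex \<open>t\<close>: it is the function
  that vanishes at \<open>t\<close>, changes by at most one along each edge, and decreases along some edge at
  each vertex other than \<open>t\<close> (\<open>gdist_eq_labelling\<close>). With it, \<open>F_rules_iff_labellings\<close> makes the
  last claim above precise. Such functions are carried along isomorphisms, so a graph is
  isomorphic to a member of the family iff it has an edge whose two ends resolve it (\<open>F_rules_of_edge_resolves\<close>,
  \<open>edge_resolves_of_F_rules\<close>). Finally \<open>cdim_le_2_iff\<close> identifies the existence of such an edge
  with \<open>cdim G \<le> 2\<close>; a resolving set with a single vertex is covered too, since any neighbour of that
  vertex can be added.
\<close>

section \<open>Local characterisation of distances\<close>

text \<open>
  This is the distance to \<open>t\<close>, described by conditions on single edges, which can be checked by
  cases and carried along isomorphisms. Descending repeatedly by the last condition gives a walk of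
  length \<open>f v\<close> from \<open>v\<close> to \<open>t\<close>; the middle condition forbids a shorter one.
\<close>

definition distance_labelling :: "'a pair_pre_digraph \<Rightarrow> 'a \<Rightarrow> ('a \<Rightarrow> nat) \<Rightarrow> bool" where
  "distance_labelling G t f \<longleftrightarrow> f t = 0 \<and>
     (\<forall>(a, b) \<in> parcs G. f a \<le> Suc (f b)) \<and>
     (\<forall>v \<in> pverts G. v \<noteq> t \<longrightarrow> (\<exists>w. (v, w) \<in> parcs G \<and> f v = Suc (f w)))"

lemma distance_labelling_zero: "distance_labelling G t f \<Longrightarrow> f t = 0"
  by (simp add: distance_labelling_def)

lemma distance_labelling_edge:
  "distance_labelling G t f \<Longrightarrow> (a, b) \<in> parcs G \<Longrightarrow> f a \<le> Suc (f b)"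
  by (auto simp: distance_labelling_def)

lemma distance_labelling_descent:
  assumes "distance_labelling G t f" and "v \<in> pverts G" and "v \<noteq> t"
  obtains w where "(v, w) \<in> parcs G" and "f v = Suc (f w)"
  using assms by (auto simp: distance_labelling_def)

lemma distance_labelling_eq_zero_iff:
  assumes "distance_labelling G t f" and "v \<in> pverts G"
  shows "f v = 0 \<longleftrightarrow> v = t"
  using assms by (auto simp: distance_labelling_def)

lemma distance_labelling_cong:
  assumes wf: "pair_wf_digraph G" and t: "t \<in> pverts G"
    and eq: "\<And>v. v \<in> pverts G \<Longrightarrow> f v = g v"
  shows "distance_labelling G t f \<longleftrightarrow> distance_labelling G t g"
proof -
  have "f a = g a \<and> f b = g b" if "(a, b) \<in> parcs G" for a b
    using pair_wf_digraph.wellformed'[OF wf that] eq by blast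
  then show ?thesis
    using t eq unfolding distance_labelling_def by (auto 0 3)
qed

text \<open>
  Along a descending walk of \<open>f\<close>, which has length \<open>f v\<close>, the function \<open>h\<close> loses at most one per
  step. For \<open>h\<close> the distance to another vertex this is the triangle inequality.
\<close>

lemma (in pair_wf_digraph) distance_labelling_maximal:
  assumes f: "distance_labelling G t f"
    and h: "\<And>a b. (a, b) \<in> parcs G \<Longrightarrow> h a \<le> Suc (h b)"
    and v: "v \<in> pverts G"
  shows "h v \<le> f v + h t"
  using v
proof (induction "f v" arbitrary: v)
  case 0
  then show ?case using distance_labelling_eq_zero_iff[OF f] by simp
next
  case (Suc n)
  then have "v \<noteq> t" using distance_labelling_zero[OF f] by auto
  then obtain w where w: "(v, w) \<in> parcs G" "f v = Suc (f w)"
    using distance_labelling_descent[OF f] Suc.prems by metis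
  have "h w \<le> f w + h t"
    using Suc w by (auto dest: in_arcsD2)
  then show ?case using h[OF w(1)] w(2) by simp
qed

lemma (in pair_wf_digraph) awalk_length_ge_labelling:
  assumes f: "distance_labelling G t f" and "awalk v p t"
  shows "f v \<le> length p"
  using assms(2)
proof (induction p arbitrary: v)
  case Nil
  then show ?case using distance_labelling_zero[OF f] by (simp add: awalk_Nil_iff)
next
  case (Cons e p)
  obtain a b where e: "e = (a, b)" by fastforce
  have "a = v" "(v, b) \<in> parcs G" "awalk b p t"
    using Cons.prems by (auto simp: awalk_Cons_iff e)
  then show ?case
    using Cons.IH distance_labelling_edge[OF f] by fastforce
qed

lemma (in pair_wf_digraph) awalk_of_labelling_length:
  assumes f: "distance_labelling G t f" and "v \<in> pverts G"
  shows "\<exists>p. awalk v p t \<and> length p = f v"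
  using assms(2)
proof (induction "f v" arbitrary: v)
  case 0
  then show ?case
    using distance_labelling_eq_zero_iff[OF f] by (intro exI[of _ "[]"]) (auto simp: awalk_Nil_iff)
next
  case (Suc n)
  then have "v \<noteq> t" using distance_labelling_zero[OF f] by auto
  then obtain w where w: "(v, w) \<in> parcs G" "f v = Suc (f w)"
    using distance_labelling_descent[OF f] Suc.prems by metis
  obtain p where "awalk w p t" "length p = f w"
    using Suc w by (metis in_arcsD2 Suc_inject)
  then show ?case using w by (intro exI[of _ "(v, w) # p"]) (auto simp: awalk_Cons_iff)
qed

lemma (in wf_digraph) awalk_cost_unit: "awalk_cost (\<lambda>_. 1) p = real (length p)"
  by (induction p) auto

lemma (in pair_wf_digraph) gdist_eq_labelling:
  assumes f: "distance_labelling G t f" and v: "v \<in> pverts G"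
  shows "gdist G v t = ereal (real (f v))"
proof -
  obtain p where p: "awalk v p t" "length p = f v"
    using awalk_of_labelling_length[OF f v] by blast
  show ?thesis
    unfolding gdist_def
  proof (rule antisym)
    show "\<mu> (\<lambda>_. 1) v t \<le> ereal (real (f v))"
      using min_cost_le_walk_cost[OF p(1), of "\<lambda>_. 1"] p(2) by (simp add: awalk_cost_unit)
    show "ereal (real (f v)) \<le> \<mu> (\<lambda>_. 1) v t"
      unfolding \<mu>_def
      by (rule INF_greatest) (auto simp: awalk_cost_unit awalk_length_ge_labelling[OF f])
  qed
qed

text \<open>
  Connectedness makes every vertex the start of a walk to \<open>t\<close>; the least length of such a walk is
  the labelling.
\<close>

lemma (in pair_graph) distance_labelling_exists:
  assumes con: "Digraph_Component.connected (with_proj G)" and t: "t \<in> pverts G"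
  shows "\<exists>f. distance_labelling G t f"
proof -
  define f where "f v = (LEAST n. \<exists>p. awalk v p t \<and> length p = n)" for v
  have le: "f v \<le> length p" if "awalk v p t" for v p
    unfolding f_def using that by (intro Least_le) blast
  have walk: "\<exists>p. awalk v p t \<and> length p = f v" if v: "v \<in> pverts G" for v
  proof -
    have "strongly_connected (with_proj G)"
      using con sym_arcs by (intro symmetric_connected_imp_strongly_connected) auto
    then have "v \<rightarrow>\<^sup>*\<^bsub>with_proj G\<^esub> t"
      using v t by (auto simp: strongly_connected_def)
    then obtain p where "awalk v p t" by (auto simp: reachable_awalk)
    then have "\<exists>n p. awalk v p t \<and> length p = n" by blast
    then show ?thesis
      unfolding f_def by (rule LeastI_ex)
  qed
  have "f t = 0" using le[of t "[]"] t by (simp add: awalk_Nil_iff)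
  moreover have edge: "f a \<le> Suc (f b)" if ab: "(a, b) \<in> parcs G" for a b
  proof -
    obtain p where p: "awalk b p t" "length p = f b"
      using walk in_arcsD2[OF ab] by blast
    have "awalk a ((a, b) # p) t" using ab p by (simp add: awalk_Cons_iff)
    then show ?thesis using le[of a "(a, b) # p"] p by simp
  qed
  moreover have "\<exists>w. (v, w) \<in> parcs G \<and> f v = Suc (f w)" if v: "v \<in> pverts G" "v \<noteq> t" for v
  proof -
    obtain p where p: "awalk v p t" "length p = f v" using walk v by blast
    then obtain e q where "p = e # q" using v by (cases p) (auto simp: awalk_Nil_iff)
    then obtain w where q: "p = (v, w) # q" "(v, w) \<in> parcs G" "awalk w q t"
      using p by (cases e) (auto simp: awalk_Cons_iff)
    \<comment> \<open>The first step of a shortest walk descends: the rest of the walk bounds \<open>f w\<close> by \<open>f v - 1\<close>.\<close>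
    then show ?thesis
      using le[of w q] edge[of v w] p by (intro exI[of _ w]) auto
  qed
  ultimately have "distance_labelling G t f"
    by (auto simp: distance_labelling_def)
  then show ?thesis by blast
qed

section \<open>Isomorphisms\<close>

lemma distance_labelling_transport:
  assumes wf: "pair_wf_digraph G" and inj: "inj_on \<phi> (pverts G)" and t: "t \<in> pverts G"
    and V: "pverts H = \<phi> ` pverts G" and E: "parcs H = map_prod \<phi> \<phi> ` parcs G"
  shows "distance_labelling H (\<phi> t) d \<longleftrightarrow> distance_labelling G t (d \<circ> \<phi>)"
proof -
  have arc_iff: "(\<phi> a, c) \<in> parcs H \<longleftrightarrow> (\<exists>b. c = \<phi> b \<and> (a, b) \<in> parcs G)" if a: "a \<in> pverts G" for a c
  proof
    assume "(\<phi> a, c) \<in> parcs H"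
    then obtain a' b where ab: "(a', b) \<in> parcs G" "\<phi> a' = \<phi> a" "c = \<phi> b"
      by (auto simp: E)
    then have "a' = a"
      using inj a pair_wf_digraph.in_arcsD1[OF wf ab(1)] by (simp add: inj_on_eq_iff)
    with ab show "\<exists>b. c = \<phi> b \<and> (a, b) \<in> parcs G" by blast
  qed (auto simp: E)
  have "(\<forall>(a, b) \<in> parcs H. d a \<le> Suc (d b)) \<longleftrightarrow> (\<forall>(a, b) \<in> parcs G. d (\<phi> a) \<le> Suc (d (\<phi> b)))"
    by (auto simp: E)
  moreover have "(\<forall>v \<in> pverts H. v \<noteq> \<phi> t \<longrightarrow> (\<exists>w. (v, w) \<in> parcs H \<and> d v = Suc (d w))) \<longleftrightarrow>
      (\<forall>v \<in> pverts G. v \<noteq> t \<longrightarrow> (\<exists>w. (v, w) \<in> parcs G \<and> d (\<phi> v) = Suc (d (\<phi> w))))"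
    using inj t by (simp add: V arc_iff inj_on_eq_iff) blast
  ultimately show ?thesis by (simp add: distance_labelling_def)
qed

text \<open>
  In a graph whose arcs are pairs of vertices, the arc part of an isomorphism is forced by its
  vertex part.
\<close>

lemma digraph_iso_with_projD:
  assumes "digraph_iso (with_proj G) (with_proj H)"
  obtains \<phi> where "inj_on \<phi> (pverts G)" "pverts H = \<phi> ` pverts G" "parcs H = map_prod \<phi> \<phi> ` parcs G"
proof -
  obtain h where h: "pre_digraph.digraph_isomorphism (with_proj G) h"
    and H: "with_proj H = app_iso h (with_proj G)"
    using assms by (auto simp: digraph_iso_def)
  have "pverts H = iso_verts h ` pverts G" "parcs H = iso_arcs h ` parcs G"
    "iso_tail h = fst" "iso_head h = snd"
    using H by (auto simp: with_proj_def app_iso_def)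
  moreover from this have "iso_arcs h e = map_prod (iso_verts h) (iso_verts h) e" if "e \<in> parcs G" for e
    using h that unfolding pre_digraph.digraph_isomorphism_def by (auto simp: prod_eq_iff)
  moreover have "inj_on (iso_verts h) (pverts G)"
    using h unfolding pre_digraph.digraph_isomorphism_def by auto
  ultimately show thesis
    by (intro that[of "iso_verts h"]) auto
qed

lemma digraph_iso_with_projI:
  assumes "pair_wf_digraph G" "inj_on \<phi> (pverts G)"
    "pverts H = \<phi> ` pverts G" "parcs H = map_prod \<phi> \<phi> ` parcs G"
  shows "digraph_iso (with_proj G) (with_proj H)"
proof -
  interpret pair_wf_digraph G by fact
  define h where "h = \<lparr>iso_verts = \<phi>, iso_arcs = map_prod \<phi> \<phi>, iso_head = snd, iso_tail = fst\<rparr>"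
  have "parcs G \<subseteq> pverts G \<times> pverts G"
    by (auto dest: wellformed')
  then have "inj_on (map_prod \<phi> \<phi>) (parcs G)"
    using map_prod_inj_on[OF assms(2) assms(2)] inj_on_subset by blast
  then have "digraph_isomorphism h"
    using assms(2) wf_digraph by (auto simp: digraph_isomorphism_def h_def)
  moreover have "with_proj H = app_iso h (with_proj G)"
    using assms by (simp add: app_iso_def h_def with_proj_def)
  ultimately show ?thesis by (auto simp: digraph_iso_def)
qed

section \<open>The family in coordinates\<close>

text \<open>
  The distances to \<open>u\<close> and to \<open>w\<close> that the name of a vertex promises.
\<close>

fun du :: "fvert \<Rightarrow> nat" where
  "du vu = 0"
| "du vw = 1"
| "du (vx a) = a"
| "du (vy a) = a"
| "du (vz a) = Suc a"

fun dw :: "fvert \<Rightarrow> nat" where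
  "dw vu = 1"
| "dw vw = 0"
| "dw (vx a) = Suc a"
| "dw (vy a) = a"
| "dw (vz a) = a"

text \<open>
  Inverse to \<open>(du, dw)\<close> on the pairs that can occur as distances to two adjacent vertices.
\<close>

definition fvert_at :: "nat \<Rightarrow> nat \<Rightarrow> fvert" where
  "fvert_at i j =
     (if i = 0 then vu else if j = 0 then vw
      else if i < j then vx i else if i = j then vy i else vz j)"

definition F_verts :: "nat \<Rightarrow> fvert set" where
  "F_verts r = {vu, vw} \<union> (\<Union>a\<in>{1..r}. {vx a, vy a, vz a})"

lemma in_F_verts [simp]:
  "vu \<in> F_verts r" "vw \<in> F_verts r"
  "vx a \<in> F_verts r \<longleftrightarrow> 1 \<le> a \<and> a \<le> r"
  "vy a \<in> F_verts r \<longleftrightarrow> 1 \<le> a \<and> a \<le> r"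
  "vz a \<in> F_verts r \<longleftrightarrow> 1 \<le> a \<and> a \<le> r"
  by (auto simp: F_verts_def)

text \<open>
  Restricting to indices \<open>a \<ge> 1\<close> matters: the coordinates of \<open>vx 0\<close> and \<open>vz 0\<close> are those of \<open>vu\<close>
  and \<open>vw\<close>.
\<close>

lemma inj_on_coordinates: "inj_on (\<lambda>p. (du p, dw p)) (F_verts r)"
proof (rule inj_onI)
  fix p q assume "p \<in> F_verts r" "q \<in> F_verts r" "(du p, dw p) = (du q, dw q)"
  then show "p = q" by (cases p; cases q) auto
qed

lemma coordinates_fvert_at:
  assumes "i \<le> Suc j" "j \<le> Suc i" "i \<noteq> 0 \<or> j \<noteq> 0"
  shows "du (fvert_at i j) = i" "dw (fvert_at i j) = j"
  using assms by (auto simp: fvert_at_def)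

lemma fvert_at_in_F_verts: "i \<le> r \<Longrightarrow> j \<le> r \<Longrightarrow> fvert_at i j \<in> F_verts r"
  by (auto simp: fvert_at_def)

text \<open>
  The list of permitted edges is not arbitrary: no other pair of distinct vertices is compatible with the
  promised distances.
\<close>

lemma permitted_edges_iff_coordinates:
  assumes "p \<in> F_verts r" and "q \<in> F_verts r"
  shows "(p, q) \<in> permitted_edges r \<union> (permitted_edges r)\<inverse> \<longleftrightarrow>
    p \<noteq> q \<and> du p \<le> Suc (du q) \<and> du q \<le> Suc (du p) \<and> dw p \<le> Suc (dw q) \<and> dw q \<le> Suc (dw p)"
  using assms by (cases p; cases q) (auto simp: permitted_edges_def)

text \<open>
  The heart of the theorem: the rules hold precisely if the names tell the truth about distances.
  From left to right, each rule supplies the descending neighbours. From right to left, for \<open>a \<ge> 2\<close> a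
  descending neighbour of \<open>x\<^sub>a\<close> towards \<open>u\<close> has first coordinate \<open>a - 1\<close> and second coordinate at
  least \<open>a\<close>, so it can only be \<open>x\<^sub>a\<^sub>-\<^sub>1\<close>; symmetrically for \<open>z\<^sub>a\<close>. A descending neighbour of
  \<open>y\<^sub>a\<close> is \<open>x\<^sub>a\<^sub>-\<^sub>1\<close> or \<open>y\<^sub>a\<^sub>-\<^sub>1\<close> towards \<open>u\<close> and \<open>z\<^sub>a\<^sub>-\<^sub>1\<close> or \<open>y\<^sub>a\<^sub>-\<^sub>1\<close> towards \<open>w\<close>, which is the
  alternative in the rule for \<open>y\<^sub>a\<close>.
\<close>

lemma F_rules_iff_labellings:
  assumes H: "pair_graph H"
  shows "F_rules r H \<longleftrightarrow> pverts H \<subseteq> F_verts r \<and> (vu, vw) \<in> parcs H \<and>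
    distance_labelling H vu du \<and> distance_labelling H vw dw"
proof -
  interpret pair_graph H by fact
  show ?thesis
  proof
    assume F: "F_rules r H"
    have V: "pverts H \<subseteq> F_verts r" and uw: "(vu, vw) \<in> parcs H"
      and E: "parcs H \<subseteq> permitted_edges r \<union> (permitted_edges r)\<inverse>"
      using F unfolding F_rules_def Let_def F_verts_def by blast+
    have wu: "(vw, vu) \<in> parcs H" using uw by (rule arcs_symmetric)
    have close: "du p \<le> Suc (du q) \<and> dw p \<le> Suc (dw q)" if "(p, q) \<in> parcs H" for p q
      using that E V permitted_edges_iff_coordinates[of p r q] wellformed'[OF that] by blast
    have descent: "(v \<noteq> vu \<longrightarrow> (\<exists>w. (v, w) \<in> parcs H \<and> du v = Suc (du w))) \<and>
      (v \<noteq> vw \<longrightarrow> (\<exists>w. (v, w) \<in> parcs H \<and> dw v = Suc (dw w)))" if v: "v \<in> pverts H" for v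
    proof (cases v)
      case vu
      then show ?thesis using uw by (auto intro!: exI[of _ vw])
    next
      case vw
      then show ?thesis using wu by (auto intro!: exI[of _ vu])
    next
      case (vx a)
      then have a: "a \<in> {1..r}" using v V by auto
      show ?thesis
      proof (cases "a = 1")
        case True
        then have "(vx 1, vu) \<in> parcs H" using F v vx by (auto simp: F_rules_def Let_def)
        then show ?thesis using vx True by (auto intro!: exI[of _ vu])
      next
        case False
        then have "(vx a, vx (a - 1)) \<in> parcs H" using F v vx a by (auto simp: F_rules_def Let_def)
        then show ?thesis using vx a by (auto intro!: exI[of _ "vx (a - 1)"])
      qed
    next
      case (vz a)
      then have a: "a \<in> {1..r}" using v V by auto
      show ?thesis
      proof (cases "a = 1")
        case True
        then have "(vz 1, vw) \<in> parcs H" using F v vz by (auto simp: F_rules_def Let_def)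
        then show ?thesis using vz True by (auto intro!: exI[of _ vw])
      next
        case False
        then have "(vz a, vz (a - 1)) \<in> parcs H" using F v vz a by (auto simp: F_rules_def Let_def)
        then show ?thesis using vz a by (auto intro!: exI[of _ "vz (a - 1)"])
      qed
    next
      case (vy a)
      then have a: "a \<in> {1..r}" using v V by auto
      show ?thesis
      proof (cases "a = 1")
        case True
        then have "(vy 1, vu) \<in> parcs H" "(vy 1, vw) \<in> parcs H"
          using F v vy by (auto simp: F_rules_def Let_def)
        then show ?thesis
          using vy True by (auto intro: exI[of _ vu] exI[of _ vw])
      next
        case False
        then have "a \<in> {2..r}" using a by auto
        then have "((vx (a - 1), vy a) \<in> parcs H \<and> (vz (a - 1), vy a) \<in> parcs H)
            \<or> (vy (a - 1), vy a) \<in> parcs H"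
          using F v vy unfolding F_rules_def Let_def by blast
        then have "((vy a, vx (a - 1)) \<in> parcs H \<and> (vy a, vz (a - 1)) \<in> parcs H)
            \<or> (vy a, vy (a - 1)) \<in> parcs H"
          using arcs_symmetric by blast
        then show ?thesis
          using vy a by (auto intro: exI[of _ "vx (a - 1)"] exI[of _ "vz (a - 1)"] exI[of _ "vy (a - 1)"])
      qed
    qed
    show "pverts H \<subseteq> F_verts r \<and> (vu, vw) \<in> parcs H \<and>
      distance_labelling H vu du \<and> distance_labelling H vw dw"
      using V uw close descent by (auto simp: distance_labelling_def)
  next
    assume "pverts H \<subseteq> F_verts r \<and> (vu, vw) \<in> parcs H \<and>
      distance_labelling H vu du \<and> distance_labelling H vw dw"
    then have V: "pverts H \<subseteq> F_verts r" and uw: "(vu, vw) \<in> parcs H"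
      and U: "distance_labelling H vu du" and W: "distance_labelling H vw dw" by auto
    have close: "p \<in> F_verts r \<and> q \<in> F_verts r \<and> p \<noteq> q \<and> du p \<le> Suc (du q) \<and> du q \<le> Suc (du p) \<and>
        dw p \<le> Suc (dw q) \<and> dw q \<le> Suc (dw p)" if "(p, q) \<in> parcs H" for p q
      using that arcs_symmetric[OF that] V wellformed'[OF that] no_loops'[OF that]
        distance_labelling_edge[OF U] distance_labelling_edge[OF W] by blast
    have "parcs H \<subseteq> permitted_edges r \<union> (permitted_edges r)\<inverse>"
      using close permitted_edges_iff_coordinates by (meson subrelI)
    moreover have to_vu: "(v, vu) \<in> parcs H" if v: "v \<in> pverts H" "du v = 1" for v
    proof -
      have "v \<noteq> vu" using v by auto
      then obtain w where w: "(v, w) \<in> parcs H" "du v = Suc (du w)"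
        using distance_labelling_descent[OF U v(1)] by blast
      then have "w = vu"
        using v(2) distance_labelling_eq_zero_iff[OF U in_arcsD2[OF w(1)]] by simp
      then show ?thesis using w by simp
    qed
    moreover have to_vw: "(v, vw) \<in> parcs H" if v: "v \<in> pverts H" "dw v = 1" for v
    proof -
      have "v \<noteq> vw" using v by auto
      then obtain w where w: "(v, w) \<in> parcs H" "dw v = Suc (dw w)"
        using distance_labelling_descent[OF W v(1)] by blast
      then have "w = vw"
        using v(2) distance_labelling_eq_zero_iff[OF W in_arcsD2[OF w(1)]] by simp
      then show ?thesis using w by simp
    qed
    moreover have "vx (a - 1) \<in> pverts H \<and> (vx a, vx (a - 1)) \<in> parcs H"
      if a: "a \<in> {2..r}" and v: "vx a \<in> pverts H" for a
    proof -
      obtain w where w: "(vx a, w) \<in> parcs H" "du (vx a) = Suc (du w)"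
        using distance_labelling_descent[OF U v] by blast
      have "w = vx (a - 1)" using close[OF w(1)] w(2) a by (cases w) auto
      then show ?thesis using w in_arcsD2 by blast
    qed
    moreover have "vz (a - 1) \<in> pverts H \<and> (vz a, vz (a - 1)) \<in> parcs H"
      if a: "a \<in> {2..r}" and v: "vz a \<in> pverts H" for a
    proof -
      obtain w where w: "(vz a, w) \<in> parcs H" "dw (vz a) = Suc (dw w)"
        using distance_labelling_descent[OF W v] by blast
      have "w = vz (a - 1)" using close[OF w(1)] w(2) a by (cases w) auto
      then show ?thesis using w in_arcsD2 by blast
    qed
    moreover have "(vx (a - 1) \<in> pverts H \<and> vz (a - 1) \<in> pverts H \<and>
          (vx (a - 1), vy a) \<in> parcs H \<and> (vz (a - 1), vy a) \<in> parcs H)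
         \<or> (vy (a - 1) \<in> pverts H \<and> (vy (a - 1), vy a) \<in> parcs H)"
      if a: "a \<in> {2..r}" and v: "vy a \<in> pverts H" for a
    proof -
      obtain w where w: "(vy a, w) \<in> parcs H" "du (vy a) = Suc (du w)"
        using distance_labelling_descent[OF U v] by blast
      obtain w' where w': "(vy a, w') \<in> parcs H" "dw (vy a) = Suc (dw w')"
        using distance_labelling_descent[OF W v] by blast
      have "w = vx (a - 1) \<or> w = vy (a - 1)" using close[OF w(1)] w(2) a by (cases w) auto
      moreover have "w' = vz (a - 1) \<or> w' = vy (a - 1)" using close[OF w'(1)] w'(2) a by (cases w') auto
      ultimately show ?thesis
        using w(1) w'(1) in_arcsD2 arcs_symmetric by blast
    qed
    ultimately show "F_rules r H"
      using uw V in_arcsD1[OF uw] in_arcsD2[OF uw] by (simp add: F_rules_def F_verts_def)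
  qed
qed

text \<open>
  The special definition of \<open>F_family 0\<close> disappears in the union over all \<open>r\<close>: \<open>P\<^sub>2\<close> obeys the
  rules with \<open>r = 1\<close>, and a graph that obeys the rules for \<open>r\<close> obeys them for \<open>r + 1\<close>,
  so that \<open>r\<close> may be taken positive.
\<close>

lemma ex_in_F_iff:
  "(\<exists>r. in_F G r) \<longleftrightarrow>
   (\<exists>r H. pair_graph H \<and> F_rules r H \<and> digraph_iso (with_proj G) (with_proj H))" (is "?L \<longleftrightarrow> ?R")
proof
  let ?P = "\<lparr>pverts = {vu, vw}, parcs = {(vu, vw), (vw, vu)}\<rparr>"
  have "pair_graph ?P"
    by unfold_locales (auto simp: symmetric_def sym_def)
  moreover have "F_rules 1 ?P"
    by (auto simp: F_rules_def permitted_edges_def)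
  moreover assume ?L
  ultimately show ?R
    unfolding in_F_def F_family_def by (auto split: if_splits)
next
  have mono: "F_rules (Suc r) H" if "F_rules r H" "pair_graph H" for r H
    using that by (auto simp: F_rules_iff_labellings F_verts_def)
  assume ?R
  then obtain r H where "pair_graph H" "F_rules r H" "digraph_iso (with_proj G) (with_proj H)"
    by blast
  then have "in_F G (Suc r)"
    using mono by (auto simp: in_F_def F_family_def)
  then show ?L ..
qed

section \<open>Resolving edges and the family\<close>

definition edge_resolves :: "'a pair_pre_digraph \<Rightarrow> 'a \<Rightarrow> 'a \<Rightarrow> bool" where
  "edge_resolves G u w \<longleftrightarrow> (u, w) \<in> parcs G \<and>
     (\<exists>f g. distance_labelling G u f \<and> distance_labelling G w g \<and>
        inj_on (\<lambda>v. (f v, g v)) (pverts G))"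

text \<open>
  Rename every vertex according to its distances to \<open>u\<close> and \<open>w\<close>. The renaming is injective because
  the edge resolves the graph, and the names are truthful by construction.
\<close>

lemma F_rules_of_edge_resolves:
  assumes G: "pair_graph G" and R: "edge_resolves G u w"
  shows "\<exists>r H. pair_graph H \<and> F_rules r H \<and> digraph_iso (with_proj G) (with_proj H)"
proof -
  interpret pair_graph G by fact
  obtain f g where uw: "(u, w) \<in> parcs G"
    and f: "distance_labelling G u f" and g: "distance_labelling G w g"
    and inj: "inj_on (\<lambda>v. (f v, g v)) (pverts G)"
    using R by (auto simp: edge_resolves_def)
  have u: "u \<in> pverts G" and w: "w \<in> pverts G" and wu: "(w, u) \<in> parcs G" and ne: "u \<noteq> w"
    using in_arcsD1[OF uw] in_arcsD2[OF uw] arcs_symmetric[OF uw] no_loops'[OF uw] by auto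
  have "f w \<le> 1" "g u \<le> 1"
    using distance_labelling_edge[OF f wu] distance_labelling_edge[OF g uw]
      distance_labelling_zero[OF f] distance_labelling_zero[OF g] by auto
  then have close: "f v \<le> Suc (g v)" "g v \<le> Suc (f v)" if "v \<in> pverts G" for v
    using distance_labelling_maximal[OF g, of f v] distance_labelling_edge[OF f]
      distance_labelling_maximal[OF f, of g v] distance_labelling_edge[OF g] that
    by (simp_all add: order.trans)
  have nz: "f v \<noteq> 0 \<or> g v \<noteq> 0" if "v \<in> pverts G" for v
    using distance_labelling_eq_zero_iff[OF f that] distance_labelling_eq_zero_iff[OF g that] ne by auto
  define \<phi> where "\<phi> v = fvert_at (f v) (g v)" for v
  have du: "du (\<phi> v) = f v" and dw: "dw (\<phi> v) = g v" if "v \<in> pverts G" for v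
    using coordinates_fvert_at[OF close[OF that] nz[OF that]] by (simp_all add: \<phi>_def)
  have \<phi>: "inj_on \<phi> (pverts G)"
    using inj du dw by (auto simp: inj_on_def) metis
  have \<phi>u: "\<phi> u = vu" and \<phi>w: "\<phi> w = vw"
    using distance_labelling_zero[OF f] distance_labelling_zero[OF g] nz[OF w]
    by (auto simp: \<phi>_def fvert_at_def)
  \<comment> \<open>Any bound on all distances would do as the index of the family.\<close>
  define r where "r = (\<Sum>v\<in>pverts G. f v + g v)"
  have "f v + g v \<le> r" if "v \<in> pverts G" for v
    unfolding r_def using that pair_finite_verts by (intro member_le_sum) auto
  then have V: "\<phi> ` pverts G \<subseteq> F_verts r"
    unfolding \<phi>_def by (intro image_subsetI fvert_at_in_F_verts) fastforce+
  define H where "H = \<lparr>pverts = \<phi> ` pverts G, parcs = map_prod \<phi> \<phi> ` parcs G\<rparr>"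
  have pH: "pverts H = \<phi> ` pverts G" and eH: "parcs H = map_prod \<phi> \<phi> ` parcs G"
    by (simp_all add: H_def)
  have H: "pair_graph H"
  proof unfold_locales
    show "symmetric (with_proj H)"
      using arcs_symmetric by (force simp: symmetric_def sym_def eH)
    show "fst e \<noteq> snd e" if e: "e \<in> parcs H" for e
    proof -
      obtain a b where ab: "(a, b) \<in> parcs G" "e = (\<phi> a, \<phi> b)"
        using e by (auto simp: eH)
      then show ?thesis
        using inj_on_eq_iff[OF \<phi>] wellformed'[OF ab(1)] no_loops'[OF ab(1)] by simp
    qed
  qed (use pair_finite_verts pair_finite_arcs in \<open>auto simp: pH eH dest: wellformed'\<close>)
  have "distance_labelling H vu du"
    using distance_labelling_transport[OF pair_wf_digraph \<phi> u pH eH, of du] f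
      distance_labelling_cong[OF pair_wf_digraph u, of "du \<circ> \<phi>" f] du by (simp add: \<phi>u)
  moreover have "distance_labelling H vw dw"
    using distance_labelling_transport[OF pair_wf_digraph \<phi> w pH eH, of dw] g
      distance_labelling_cong[OF pair_wf_digraph w, of "dw \<circ> \<phi>" g] dw by (simp add: \<phi>w)
  moreover have "(vu, vw) \<in> parcs H"
    using uw \<phi>u \<phi>w by (force simp: eH)
  ultimately have "F_rules r H"
    using V by (simp add: F_rules_iff_labellings[OF H] pH)
  moreover have "digraph_iso (with_proj G) (with_proj H)"
    using pair_wf_digraph \<phi> pH eH by (rule digraph_iso_with_projI)
  ultimately show ?thesis using H by blast
qed

text \<open>
  A vertex of the family is determined by its coordinates, and these are its distances to the ends
  of the edge \<open>uw\<close>.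
\<close>

lemma edge_resolves_of_F_rules:
  assumes G: "pair_graph G" and H: "pair_graph H" and F: "F_rules r H"
    and iso: "digraph_iso (with_proj G) (with_proj H)"
  shows "\<exists>u w. edge_resolves G u w"
proof -
  interpret pair_graph G by fact
  obtain \<phi> where \<phi>: "inj_on \<phi> (pverts G)"
    and pH: "pverts H = \<phi> ` pverts G" and eH: "parcs H = map_prod \<phi> \<phi> ` parcs G"
    using iso by (rule digraph_iso_with_projD)
  have V: "pverts H \<subseteq> F_verts r" and "(vu, vw) \<in> parcs H"
    and U: "distance_labelling H vu du" and W: "distance_labelling H vw dw"
    using F by (simp_all add: F_rules_iff_labellings[OF H])
  then obtain u w where uw: "(u, w) \<in> parcs G" and \<phi>u: "\<phi> u = vu" and \<phi>w: "\<phi> w = vw"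
    by (auto simp: eH)
  have "distance_labelling G u (du \<circ> \<phi>)" "distance_labelling G w (dw \<circ> \<phi>)"
    using distance_labelling_transport[OF pair_wf_digraph \<phi> in_arcsD1[OF uw] pH eH, of du]
      distance_labelling_transport[OF pair_wf_digraph \<phi> in_arcsD2[OF uw] pH eH, of dw] U W
    by (simp_all add: \<phi>u \<phi>w)
  moreover have "inj_on (\<lambda>v. ((du \<circ> \<phi>) v, (dw \<circ> \<phi>) v)) (pverts G)"
    using comp_inj_on[OF \<phi> inj_on_subset[OF inj_on_coordinates V[unfolded pH]]]
    by (simp add: o_def)
  ultimately show ?thesis using uw unfolding edge_resolves_def by blast
qed

section \<open>Connected resolving sets with at most two vertices\<close>

lemma (in pair_graph) connected_induce_pair:
  assumes uw: "(u, w) \<in> parcs G"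
  shows "Digraph_Component.connected (with_proj G \<restriction> {u, w})"
proof -
  let ?M = "mk_symmetric (with_proj G \<restriction> {u, w})"
  have V: "pverts ?M = {u, w}" by simp
  have E: "(u, w) \<in> parcs ?M" "(w, u) \<in> parcs ?M"
    using uw by (auto simp: parcs_mk_symmetric)
  interpret M: pair_wf_digraph ?M
    by (intro wf_digraph.wellformed_mk_symmetric wellformed_induce_subgraph)
  show ?thesis
    unfolding connected_def strongly_connected_def using E V by auto
qed

lemma (in pair_graph) arc_of_connected_pair:
  assumes "Digraph_Component.connected (with_proj G \<restriction> {u, w})" and "u \<noteq> w"
  shows "(u, w) \<in> parcs G"
proof -
  let ?M = "mk_symmetric (with_proj G \<restriction> {u, w})"
  interpret M: pair_wf_digraph ?M
    by (intro wf_digraph.wellformed_mk_symmetric wellformed_induce_subgraph)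
  have "u \<rightarrow>\<^sup>*\<^bsub>with_proj ?M\<^esub> w"
    using assms(1) unfolding connected_def strongly_connected_def by simp
  then have "(u, w) \<in> (parcs ?M)\<^sup>*"
    using reachable_rtranclI[of "with_proj ?M" u w] by simp
  then obtain y where "(u, y) \<in> parcs ?M"
    using assms(2) by (auto elim: converse_rtranclE)
  then show ?thesis
    using no_loops' arcs_symmetric by (auto simp: parcs_mk_symmetric)
qed

lemma (in pair_wf_digraph) resolving_set_iff_labellings:
  assumes "S \<subseteq> pverts G" and "\<And>z. z \<in> S \<Longrightarrow> distance_labelling G z (f z)"
  shows "resolving_set G S \<longleftrightarrow>
    (\<forall>x \<in> pverts G. \<forall>y \<in> pverts G. x \<noteq> y \<longrightarrow> (\<exists>z \<in> S. f z x \<noteq> f z y))"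
proof -
  have "gdist G x z = ereal (real (f z x))" if "z \<in> S" "x \<in> pverts G" for x z
    using gdist_eq_labelling[OF assms(2)] that by blast
  then show ?thesis
    using assms(1) by (simp add: resolving_set_def)
qed

text \<open>
  This guarantees that the minimum that defines \<open>cdim\<close> is attained: a vertex is told apart from all
  others by its distance zero to itself.
\<close>

lemma (in pair_graph) connected_resolving_set_pverts:
  assumes con: "Digraph_Component.connected (with_proj G)"
  shows "connected_resolving_set G (pverts G)"
proof -
  obtain f where f: "distance_labelling G z (f z)" if "z \<in> pverts G" for z
    using distance_labelling_exists[OF con] by metis
  have "f y x \<noteq> f y y" if "x \<in> pverts G" "y \<in> pverts G" "x \<noteq> y" for x y
    using that distance_labelling_eq_zero_iff[OF f] by metis
  then have "resolving_set G (pverts G)"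
    using resolving_set_iff_labellings[of "pverts G" f] f by blast
  moreover have "with_proj G \<restriction> pverts G = with_proj G"
    by (auto simp: induce_subgraph_def with_proj_def dest: wellformed')
  ultimately show ?thesis
    using con by (simp add: connected_resolving_set_def)
qed

text \<open>
  A connected resolving set with at most two vertices is the pair of ends of an edge or a single
  vertex; in the second case any neighbour completes it to such a pair.
\<close>

lemma (in pair_graph) cdim_le_2_iff:
  assumes con: "Digraph_Component.connected (with_proj G)" and two: "card (pverts G) \<ge> 2"
  shows "cdim G \<le> 2 \<longleftrightarrow> (\<exists>u w. edge_resolves G u w)"
proof
  assume "\<exists>u w. edge_resolves G u w"
  then obtain u w f g where uw: "(u, w) \<in> parcs G"
    and fg: "distance_labelling G u f" "distance_labelling G w g"
    and inj: "inj_on (\<lambda>v. (f v, g v)) (pverts G)"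
    by (auto simp: edge_resolves_def)
  have ne: "u \<noteq> w" using no_loops'[OF uw] .
  define h where "h z = (if z = u then f else g)" for z
  have "distance_labelling G z (h z)" if "z \<in> {u, w}" for z
    using that fg by (auto simp: h_def)
  then have "resolving_set G {u, w} \<longleftrightarrow>
      (\<forall>x \<in> pverts G. \<forall>y \<in> pverts G. x \<noteq> y \<longrightarrow> (\<exists>z \<in> {u, w}. h z x \<noteq> h z y))"
    using wellformed'[OF uw] by (intro resolving_set_iff_labellings) auto
  then have "resolving_set G {u, w}"
    using inj ne by (auto simp: h_def inj_on_def)
  then have "connected_resolving_set G {u, w}"
    using connected_induce_pair[OF uw] by (simp add: connected_resolving_set_def)
  moreover have "card {u, w} = 2" using ne by simp
  ultimately show "cdim G \<le> 2"
    unfolding cdim_def by (intro Least_le) blast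
next
  assume le: "cdim G \<le> 2"
  have "\<exists>k S. connected_resolving_set G S \<and> card S = k"
    using connected_resolving_set_pverts[OF con] by blast
  then have "\<exists>S. connected_resolving_set G S \<and> card S = cdim G"
    unfolding cdim_def by (rule LeastI_ex)
  then obtain S where S: "connected_resolving_set G S" "card S \<le> 2" using le by metis
  have R: "resolving_set G S" and SV: "S \<subseteq> pverts G"
    and SC: "Digraph_Component.connected (with_proj G \<restriction> S)"
    using S by (auto simp: connected_resolving_set_def resolving_set_def)
  have fin: "finite S" using SV pair_finite_verts finite_subset by blast
  have "S \<noteq> {}" using SC by (auto simp: connected_def strongly_connected_def)
  obtain f where f: "distance_labelling G z (f z)" if "z \<in> pverts G" for z
    using distance_labelling_exists[OF con] by metis
  have "\<exists>u w. (u, w) \<in> parcs G \<and> S \<subseteq> {u, w}"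
  proof (cases "card S = 1")
    case True
    then obtain u where u: "S = {u}" by (auto simp: card_1_singleton_iff)
    have "\<not> pverts G \<subseteq> {u}"
      using two card_mono[of "{u}" "pverts G"] by auto
    then obtain v where v: "v \<in> pverts G" "u \<noteq> v" by blast
    then obtain w where "(u, w) \<in> parcs G"
      using distance_labelling_descent[OF f[OF v(1)], of u] SV u by auto
    then show ?thesis using u by blast
  next
    case False
    then have "card S = 2"
      using S(2) fin \<open>S \<noteq> {}\<close> by (simp add: le_Suc_eq numeral_2_eq_2)
    then obtain u w where "S = {u, w}" "u \<noteq> w" by (auto simp: card_2_iff)
    then show ?thesis using arc_of_connected_pair[of u w] SC by blast
  qed
  then obtain u w where uw: "(u, w) \<in> parcs G" and sub: "S \<subseteq> {u, w}" by blast
  have "inj_on (\<lambda>v. (f u v, f w v)) (pverts G)"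
    using R sub resolving_set_iff_labellings[OF SV, of f] f SV by (fastforce simp: inj_on_def)
  then have "edge_resolves G u w"
    using uw f wellformed'[OF uw] by (auto simp: edge_resolves_def)
  then show "\<exists>u w. edge_resolves G u w" by blast
qed

theorem theorem4p2:
  fixes G :: "'a pair_pre_digraph"
  assumes "pair_graph G"
    and "Digraph_Component.connected (with_proj G)"
    and "card (pverts G) \<ge> 2"
  shows "cdim G \<le> 2 \<longleftrightarrow> (\<exists>r. in_F G r)"
  unfolding pair_graph.cdim_le_2_iff[OF assms] ex_in_F_iff
  using F_rules_of_edge_resolves[OF assms(1)] edge_resolves_of_F_rules[OF assms(1)] by blast

end
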